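(* Let $m,n,l\ge 1$ be integers, let $\mathcal X=\{\mathbf x^{(1)},\dots,\mathbf x^{(l)}\}$ with $\mathbf x^{(i)}\in\mathbb R^n$ and $\mathcal Y=\{\mathbf y^{(1)},\dots,\mathbf y^{(l)}\}$ with $\mathbf y^{(i)}\in\mathbb R^m$, $1\le i\le l$, be given, and let $\beta>0$ and $s\neq 0$ be real numbers. Let $G\in\mathbb R^{m\times n}$, $u^{(4)}\in\mathbb R$, $\mathbf u^{(2)}\in\mathbb R^m$ and $\mathbf h\in\mathbb R^n$ all have i.i.d. standard normal components and be independent of each other. For $t\in[0,1]$ define $$\psi(\mathcal X,\mathcal Y,\beta,s,t)=\mathbb E_{G,u^{(4)},\mathbf u^{(2)},\mathbf h}\,\frac{1}{\beta|s|\sqrt n}\log\left(\sum_{i_1=1}^{l}\left(\sum_{i_2=1}^{l}e^{\beta H_t^{(i_1,i_2)}}\right)^{s}\right),$$ where $$H_t^{(i_1,i_2)}=\sqrt t\,(\mathbf y^{(i_2)})^TG\mathbf x^{(i_1)}+\sqrt{1-t}\,\|\mathbf x^{(i_1)}\|_2(\mathbf y^{(i_2)})^T\mathbf u^{(2)}+\sqrt t\,\|\mathbf x^{(i_1)}\|_2\|\mathbf y^{(i_2)}\|_2\,u^{(4)}+\sqrt{1-t}\,\|\mathbf y^{(i_2)}\|_2\,\mathbf h^T\mathbf x^{(i_1)}.$$ Then $t\mapsto\psi(\mathcal X,\mathcal Y,\beta,s,t)$ is non-increasing on $[0,1]$.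
   Context: $\mathbb E$ denotes expectation over the Gaussian variables indicated in the subscript. The vectors indexed in $\mathcal X$ and $\mathcal Y$ are deterministic, and sums run over the indices $1,\dots,l$. *)

theory Defs
  imports "HOL-Probability.Probability"
begin

text \<open>
  The scalar components of a random matrix, a random scalar and two random vectors, collected
  into a single family, so that "all components are i.i.d. and the four objects are independent
  of each other" is joint independence of this family.
\<close>

definition scalar_components ::
  "('w \<Rightarrow> real ^ 'n ^ 'm) \<Rightarrow> ('w \<Rightarrow> real) \<Rightarrow> ('w \<Rightarrow> real ^ 'm) \<Rightarrow> ('w \<Rightarrow> real ^ 'n) \<Rightarrow>
   ('m \<times> 'n) + unit + 'm + 'n \<Rightarrow> 'w \<Rightarrow> real" where
  "scalar_components G u4 u2 h =
     case_sum (\<lambda>(i, j) \<omega>. G \<omega> $ i $ j)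
       (case_sum (\<lambda>_. u4)
         (case_sum (\<lambda>i \<omega>. u2 \<omega> $ i) (\<lambda>j \<omega>. h \<omega> $ j)))"

definition iid_std_normal :: "'w measure \<Rightarrow> ('i \<Rightarrow> 'w \<Rightarrow> real) \<Rightarrow> bool" where
  "iid_std_normal M Z \<longleftrightarrow>
     prob_space.indep_vars M (\<lambda>_. borel) Z UNIV \<and>
     (\<forall>i. distributed M lborel (Z i) std_normal_density)"

text \<open>Here \<open>x\<close> and \<open>y\<close> are a single pair of vectors, and \<open>A\<close>, \<open>a\<close>, \<open>b\<close>, \<open>c\<close> are
  realizations of the Gaussian matrix, scalar and vectors.\<close>

definition H ::
  "real ^ 'n ^ 'm \<Rightarrow> real \<Rightarrow> real ^ 'm \<Rightarrow> real ^ 'n \<Rightarrow> real \<Rightarrow> real ^ 'n \<Rightarrow> real ^ 'm \<Rightarrow> real" where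
  "H A a b c t x y =
     sqrt t * (y \<bullet> (A *v x)) + sqrt (1 - t) * norm x * (y \<bullet> b)
     + sqrt t * norm x * norm y * a + sqrt (1 - t) * norm y * (c \<bullet> x)"

definition psi ::
  "'w measure \<Rightarrow> ('w \<Rightarrow> real ^ 'n ^ 'm) \<Rightarrow> ('w \<Rightarrow> real) \<Rightarrow> ('w \<Rightarrow> real ^ 'm) \<Rightarrow> ('w \<Rightarrow> real ^ 'n) \<Rightarrow>
   nat \<Rightarrow> (nat \<Rightarrow> real ^ 'n) \<Rightarrow> (nat \<Rightarrow> real ^ 'm) \<Rightarrow> real \<Rightarrow> real \<Rightarrow> real \<Rightarrow> real" where
  "psi M G u4 u2 h l x y \<beta> s t =
     (LINT \<omega>|M. 1 / (\<beta> * \<bar>s\<bar> * sqrt (real CARD('n))) *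
        ln (\<Sum>i1 = 1..l. (\<Sum>i2 = 1..l.
              exp (\<beta> * H (G \<omega>) (u4 \<omega>) (u2 \<omega>) (h \<omega>) t (x i1) (y i2))) powr s))"

end

theory Submission
  imports Defs "HOL-Real_Asymp.Real_Asymp"
begin

text \<open>
  With \<open>t = (sin \<theta>)\<^sup>2\<close> the process becomes \<open>sin \<theta> A + cos \<theta> B\<close> for independent Gaussian fields
  \<open>A\<close>, \<open>B\<close>, which is differentiable in \<open>\<theta>\<close> up to the end points. Differentiating under the
  expectation and integrating by parts in every Gaussian variable, the derivative is a sum over
  pairs of indices of second derivatives of the log-partition function, weighted by
  \<open>sin \<theta> cos \<theta>\<close> times the difference of the covariances of \<open>A\<close> and \<open>B\<close>. This difference is
  \<open>(|x| |x'| - x \<bullet> x') (|y| |y'| - y \<bullet> y')\<close>: it is nonnegative, and it vanishes when \<open>x = x'\<close>. So only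
  the second derivatives with \<open>i\<^sub>1 \<noteq> i\<^sub>1'\<close> survive, and these equal \<open>-s\<^sup>2\<close> times a product of Gibbs
  weights, whatever the sign of \<open>s\<close>.
\<close>

section \<open>Gaussian integration by parts\<close>

text \<open>The standard normal density \<open>d\<close> satisfies \<open>d' y = - y * d y\<close>,
  so \<open>\<phi>' y * d y - y * \<phi> y * d y\<close> is the derivative of
  \<open>\<phi> y * d y\<close>. Its integral over the line is a difference of limits, both 0
  because \<open>\<phi>\<close> is bounded. The bounds also make the two parts integrable
  separately, which lets the integral be split.\<close>

lemma std_normal_ibp:
  fixes \<phi> \<phi>' :: "real \<Rightarrow> real"
  assumes deriv: "\<And>y. (\<phi> has_real_derivative \<phi>' y) (at y)"
    and cont: "\<And>y. isCont \<phi>' y"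
    and bound: "\<And>y. \<bar>\<phi> y\<bar> \<le> C" "\<And>y. \<bar>\<phi>' y\<bar> \<le> D"
  shows "(LINT y|density lborel std_normal_density. y * \<phi> y)
    = (LINT y|density lborel std_normal_density. \<phi>' y)"
proof -
  let ?d = "std_normal_density"
  let ?f = "\<lambda>y. ?d y * \<phi>' y - ?d y * (y * \<phi> y)"
  have cont\<phi>: "isCont \<phi> y" for y
    using DERIV_isCont deriv by blast
  define c where "c = 1 / sqrt (2 * pi)"
  have d_eq: "?d = (\<lambda>y. c * exp (- y\<^sup>2 / 2))"
    by (simp add: fun_eq_iff std_normal_density_def c_def)
  have d_deriv: "(?d has_real_derivative - (y * ?d y)) (at y)" for y
    unfolding d_eq by (auto intro!: derivative_eq_intros)
  have [measurable]: "\<phi> \<in> borel_measurable borel" "\<phi>' \<in> borel_measurable borel"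
    using cont cont\<phi> by (auto intro!: borel_measurable_continuous_onI simp: continuous_on_eq_continuous_at)
  have i1: "integrable lborel (\<lambda>y. ?d y * \<phi>' y)"
  proof (rule Bochner_Integration.integrable_bound)
    show "integrable lborel (\<lambda>y. D * ?d y)" by simp
    show "AE y in lborel. norm (?d y * \<phi>' y) \<le> norm (D * ?d y)"
      using order_trans[OF abs_ge_zero bound(2)[of 0]] bound(2)
      by (auto simp: abs_mult mult.commute intro!: mult_mono)
  qed auto
  have i2: "integrable lborel (\<lambda>y. ?d y * (y * \<phi> y))"
  proof (rule Bochner_Integration.integrable_bound)
    show "integrable lborel (\<lambda>y. C * (?d y * \<bar>y\<bar> ^ 1))"
      by (intro integrable_mult_right integrable_std_normal_moment_abs)
    have "0 \<le> C"
      using order_trans[OF abs_ge_zero bound(1)] .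
    moreover have "(?d y * \<bar>y\<bar>) * \<bar>\<phi> y\<bar> \<le> (?d y * \<bar>y\<bar>) * C" for y
      by (intro mult_left_mono bound) simp
    ultimately show "AE y in lborel. norm (?d y * (y * \<phi> y)) \<le> norm (C * (?d y * \<bar>y\<bar> ^ 1))"
      by (simp add: abs_mult mult_ac)
  qed auto
  \<comment> \<open>The filter is left arbitrary so that one argument serves both ends of the
    line.\<close>
  have lim: "((\<lambda>y. \<phi> y * ?d y) \<longlongrightarrow> 0) F" if "(?d \<longlongrightarrow> 0) F" for F
  proof (rule Lim_null_comparison)
    show "\<forall>\<^sub>F y in F. norm (\<phi> y * ?d y) \<le> C * ?d y"
      using bound(1) by (auto simp: abs_mult intro!: always_eventually mult_right_mono)
    show "((\<lambda>y. C * ?d y) \<longlongrightarrow> 0) F"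
      by (rule tendsto_mult_right_zero[OF that])
  qed
  have "(LBINT y=-\<infinity>..\<infinity>. ?f y) = 0 - 0"
  proof (rule interval_integral_FTC_integrable[where F="\<lambda>y. \<phi> y * ?d y"])
    show "((\<lambda>y. \<phi> y * ?d y) has_vector_derivative ?f y) (at y)" for y
      unfolding has_real_derivative_iff_has_vector_derivative[symmetric]
      by (rule DERIV_cong[OF DERIV_mult[OF deriv d_deriv]]) (simp add: algebra_simps)
    show "isCont ?f y" for y
      by (intro continuous_intros cont cont\<phi> DERIV_isCont[OF d_deriv])
    show "set_integrable lborel (einterval (- \<infinity>) \<infinity>) ?f"
      using i1 i2 by (auto simp: set_integrable_def)
    show "(((\<lambda>y. \<phi> y * ?d y) \<circ> real_of_ereal) \<longlongrightarrow> 0) (at_right (- \<infinity>))"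
      unfolding ereal_tendsto_simps by (rule lim, unfold std_normal_density_def, real_asymp)
    show "(((\<lambda>y. \<phi> y * ?d y) \<circ> real_of_ereal) \<longlongrightarrow> 0) (at_left \<infinity>)"
      unfolding ereal_tendsto_simps by (rule lim, unfold std_normal_density_def, real_asymp)
  qed auto
  then have "(LINT y|lborel. ?f y) = 0"
    by (simp add: interval_lebesgue_integral_def set_lebesgue_integral_def)
  then show ?thesis
    using i1 i2 by (simp add: integral_density)
qed

text \<open>Independence enters the proof here: the joint law is a product measure, to which Fubini
  applies.\<close>

lemma iid_std_normal_distr:
  fixes Z :: "'k::finite \<Rightarrow> 'w \<Rightarrow> real"
  assumes "prob_space M" "iid_std_normal M Z"
  shows "distr M (Pi\<^sub>M UNIV (\<lambda>_. borel)) (\<lambda>\<omega> k. Z k \<omega>)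
    = Pi\<^sub>M UNIV (\<lambda>_. density lborel std_normal_density)"
proof -
  interpret prob_space M by fact
  have rv: "random_variable borel (Z k)" for k
    using assms(2) by (auto simp: iid_std_normal_def distributed_def)
  have "distr M borel (Z k) = density lborel std_normal_density" for k
    using assms(2) distributed_distr_eq_density[of M lborel "Z k" "std_normal_density"]
    by (auto simp: iid_std_normal_def cong: distr_cong)
  then show ?thesis
    using indep_vars_iff_distr_eq_PiM[where I=UNIV and M'="\<lambda>_. borel" and X=Z] rv assms(2)
    by (simp add: iid_std_normal_def restrict_UNIV)
qed

lemma iid_std_normal_integrable:
  assumes "prob_space M" "iid_std_normal M Z"
  shows "integrable M (Z k)"
proof -
  have "distributed M lborel (Z k) std_normal_density"
    using assms(2) by (auto simp: iid_std_normal_def)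
  from distributed_integrable[OF this, of "\<lambda>x. x"] show ?thesis
    using integrable_std_normal_moment[of 1] by simp
qed

text \<open>Freezing all coordinates but the \<open>k\<close>-th leaves a one-variable integral for
  \<open>std_normal_ibp\<close>, with \<open>f'\<close> the partial derivative in that coordinate.
  The bounds and the first moment of \<open>Z k\<close> justify Fubini.\<close>

lemma iid_std_normal_ibp:
  fixes Z :: "'k::finite \<Rightarrow> 'w \<Rightarrow> real"
  assumes "prob_space M" "iid_std_normal M Z"
    and meas: "f \<in> borel_measurable (Pi\<^sub>M UNIV (\<lambda>_. borel))"
      "f' \<in> borel_measurable (Pi\<^sub>M UNIV (\<lambda>_. borel))"
    and deriv: "\<And>z y. ((\<lambda>y. f (z(k := y))) has_real_derivative f' (z(k := y))) (at y)"
    and cont: "\<And>z y. isCont (\<lambda>y. f' (z(k := y))) y"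
    and bound: "\<And>z. \<bar>f z\<bar> \<le> C" "\<And>z. \<bar>f' z\<bar> \<le> D"
  shows "(LINT \<omega>|M. Z k \<omega> * f (\<lambda>k. Z k \<omega>)) = (LINT \<omega>|M. f' (\<lambda>k. Z k \<omega>))"
proof -
  interpret prob_space M by fact
  let ?N = "density lborel (\<lambda>x. ennreal (std_normal_density x)) :: real measure"
  let ?P = "Pi\<^sub>M (UNIV :: 'k set) (\<lambda>_. ?N)"
  have N: "prob_space ?N"
    by (rule prob_space_normal_density) simp
  interpret N: product_prob_space "\<lambda>_ :: 'k. ?N" UNIV
    using N by (rule product_prob_spaceI)
  have rv[measurable]: "random_variable borel (Z k)" for k
    using assms(2) by (auto simp: iid_std_normal_def distributed_def)
  have Z[measurable]: "(\<lambda>\<omega> k. Z k \<omega>) \<in> M \<rightarrow>\<^sub>M Pi\<^sub>M UNIV (\<lambda>_. borel)"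
    by (rule measurable_PiM_single') auto
  have sets: "sets ?P = sets (Pi\<^sub>M UNIV (\<lambda>_. borel))"
    by (intro sets_PiM_cong) auto
  have measP: "f \<in> borel_measurable ?P" "f' \<in> borel_measurable ?P"
    using meas measurable_cong_sets[OF sets refl] by blast+
  have compP: "(\<lambda>z. z k) \<in> borel_measurable ?P"
    using measurable_cong_sets[OF sets refl] measurable_component_singleton[of k UNIV "\<lambda>_. borel"] by auto
  note distr = iid_std_normal_distr[OF assms(1,2)]
  have transfer: "(LINT \<omega>|M. g (\<lambda>k. Z k \<omega>)) = (LINT z|?P. g z)"
    if "g \<in> borel_measurable (Pi\<^sub>M UNIV (\<lambda>_. borel))" for g :: "_ \<Rightarrow> real"
    using integral_distr[OF Z that] distr by simp
  have i2: "integrable ?P f'"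
    by (rule N.P.integrable_const_bound[where B=D]) (use bound(2) measP in auto)
  have "integrable ?P (\<lambda>z. z k)"
    unfolding distr[symmetric] using iid_std_normal_integrable[OF assms(1,2)]
    by (subst integrable_distr_eq) auto
  then have i1: "integrable ?P (\<lambda>z. z k * f z)"
  proof (rule Bochner_Integration.integrable_bound[OF integrable_mult_left[of C]])
    show "AE z in ?P. norm (z k * f z) \<le> norm (z k * C)"
      using order_trans[OF abs_ge_zero bound(1)] bound(1)
      by (auto simp: abs_mult intro!: mult_left_mono)
  qed (use measP compP in auto)
  have U: "insert k (UNIV - {k}) = UNIV" by auto
  \<comment> \<open>Fubini with coordinate \<open>k\<close> integrated innermost; the value of
    \<open>z\<close> at \<open>k\<close> is overwritten by \<open>y\<close>.\<close>
  have split: "(LINT z|?P. g z) = (LINT z|Pi\<^sub>M (UNIV - {k}) (\<lambda>_. ?N). LINT y|?N. g (z(k := y)))"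
    if "integrable ?P g" for g :: "_ \<Rightarrow> real"
    using N.product_integral_insert[of "UNIV - {k}" k g] that unfolding U by simp
  have "(LINT z|?P. z k * f z) = (LINT z|?P. f' z)"
    unfolding split[OF i1] split[OF i2]
    by (simp add: std_normal_ibp[OF deriv cont bound(1) bound(2)])
  then show ?thesis
    using transfer[of "\<lambda>z. z k * f z"] transfer[OF meas(2)] meas by simp
qed

section \<open>Differentiation under the integral sign\<close>

text \<open>By the mean value inequality \<open>g\<close> bounds every difference quotient, so
  dominated convergence applies along each sequence tending to \<open>t\<close>.\<close>

lemma has_real_derivative_integral:
  fixes f f' :: "real \<Rightarrow> 'w \<Rightarrow> real"
  assumes deriv: "\<And>t \<omega>. ((\<lambda>t. f t \<omega>) has_real_derivative f' t \<omega>) (at t)"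
    and bound: "\<And>t \<omega>. \<bar>f' t \<omega>\<bar> \<le> g \<omega>"
    and int: "\<And>t. integrable M (f t)" "integrable M g"
    and meas: "\<And>t. f' t \<in> borel_measurable M"
  shows "((\<lambda>t. LINT \<omega>|M. f t \<omega>) has_real_derivative (LINT \<omega>|M. f' t \<omega>)) (at t)"
  unfolding has_field_derivative_iff tendsto_at_iff_sequentially
proof (intro allI impI)
  fix X :: "nat \<Rightarrow> real" assume X: "\<forall>n. X n \<in> UNIV - {t}" "X \<longlonglongrightarrow> t"
  have q: "\<bar>(f u \<omega> - f t \<omega>) / (u - t)\<bar> \<le> g \<omega>" if "u \<noteq> t" for u \<omega>
  proof -
    have "norm (f u \<omega> - f t \<omega>) \<le> g \<omega> * norm (u - t)"
      by (rule field_differentiable_bound[of UNIV "\<lambda>t. f t \<omega>" "\<lambda>t. f' t \<omega>"]) (use deriv bound in auto)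
    then show ?thesis using that by (simp add: field_simps)
  qed
  have "(\<lambda>n. LINT \<omega>|M. (f (X n) \<omega> - f t \<omega>) / (X n - t)) \<longlonglongrightarrow> (LINT \<omega>|M. f' t \<omega>)"
  proof (rule integral_dominated_convergence[where w=g])
    show "AE \<omega> in M. (\<lambda>n. (f (X n) \<omega> - f t \<omega>) / (X n - t)) \<longlonglongrightarrow> f' t \<omega>"
      using deriv[of _ t] X unfolding has_field_derivative_iff tendsto_at_iff_sequentially
      by (auto simp: comp_def)
    show "AE \<omega> in M. norm ((f (X n) \<omega> - f t \<omega>) / (X n - t)) \<le> g \<omega>" for n
      using q[of "X n"] X by auto
  qed (use int meas in auto)
  then show "((\<lambda>u. ((LINT \<omega>|M. f u \<omega>) - (LINT \<omega>|M. f t \<omega>)) / (u - t)) \<circ> X)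
    \<longlonglongrightarrow> (LINT \<omega>|M. f' t \<omega>)"
    using int(1) by (simp add: comp_def)
qed

section \<open>The two-level Gibbs measure\<close>

locale two_level_gibbs =
  fixes I :: "'i set" and J :: "'j set" and s :: real
  assumes finite_I: "finite I" and I_nonempty: "I \<noteq> {}"
    and finite_J: "finite J" and J_nonempty: "J \<noteq> {}"
begin

definition inner_Z :: "('i \<Rightarrow> 'j \<Rightarrow> real) \<Rightarrow> 'i \<Rightarrow> real" where
  "inner_Z h i = (\<Sum>j\<in>J. exp (h i j))"

text \<open>For \<open>h\<close> equal to \<beta> times the process \<open>H\<close>, this is the
  argument of the logarithm in \<open>psi\<close>.\<close>

definition outer_Z :: "('i \<Rightarrow> 'j \<Rightarrow> real) \<Rightarrow> real" where
  "outer_Z h = (\<Sum>i\<in>I. inner_Z h i powr s)"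

text \<open>A probability on pairs: \<open>i\<close> has weight
  \<open>inner_Z h i powr s / outer_Z h\<close>, and given \<open>i\<close>, \<open>j\<close> has
  weight \<open>exp (h i j) / inner_Z h i\<close>. Up to the factor \<open>s\<close>, it is the
  gradient of \<open>ln (outer_Z h)\<close>.\<close>

definition gibbs :: "('i \<Rightarrow> 'j \<Rightarrow> real) \<Rightarrow> 'i \<Rightarrow> 'j \<Rightarrow> real" where
  "gibbs h i j = exp (h i j) * inner_Z h i powr (s - 1) / outer_Z h"

definition gibbs_avg :: "('i \<Rightarrow> 'j \<Rightarrow> real) \<Rightarrow> ('i \<Rightarrow> 'j \<Rightarrow> real) \<Rightarrow> real" where
  "gibbs_avg h v = (\<Sum>i\<in>I. \<Sum>j\<in>J. gibbs h i j * v i j)"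

text \<open>The conditional mean of \<open>v i\<close> over the inner index, given the outer index
  \<open>i\<close>.\<close>

definition inner_avg :: "('i \<Rightarrow> 'j \<Rightarrow> real) \<Rightarrow> ('i \<Rightarrow> 'j \<Rightarrow> real) \<Rightarrow> 'i \<Rightarrow> real" where
  "inner_avg h v i = (\<Sum>j\<in>J. exp (h i j) / inner_Z h i * v i j)"

text \<open>The derivative of the weight \<open>gibbs h i j\<close> when \<open>h\<close> moves with velocity \<open>v\<close>.\<close>

definition gibbs_deriv :: "('i \<Rightarrow> 'j \<Rightarrow> real) \<Rightarrow> ('i \<Rightarrow> 'j \<Rightarrow> real) \<Rightarrow> 'i \<Rightarrow> 'j \<Rightarrow> real" where
  "gibbs_deriv h v i j = gibbs h i j * (v i j + (s - 1) * inner_avg h v i - s * gibbs_avg h v)"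

section \<open>Positivity, normalization, and bounds uniform in the energies\<close>

lemma inner_Z_pos [simp]: "inner_Z h i > 0"
  unfolding inner_Z_def using finite_J J_nonempty by (intro sum_pos) auto

lemma inner_Z_nz [simp]: "inner_Z h i \<noteq> 0"
  using inner_Z_pos[of h i] by linarith

lemma outer_Z_pos [simp]: "outer_Z h > 0"
  unfolding outer_Z_def using finite_I I_nonempty by (intro sum_pos) auto

lemma outer_Z_nz [simp]: "outer_Z h \<noteq> 0"
  using outer_Z_pos[of h] by linarith

lemma gibbs_nonneg: "gibbs h i j \<ge> 0"
  unfolding gibbs_def using less_imp_le[OF outer_Z_pos]
  by (intro divide_nonneg_nonneg mult_nonneg_nonneg) auto

lemma sum_gibbs: "(\<Sum>i\<in>I. \<Sum>j\<in>J. gibbs h i j) = 1"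
proof -
  have "(\<Sum>i\<in>I. \<Sum>j\<in>J. gibbs h i j) = (\<Sum>i\<in>I. inner_Z h i * inner_Z h i powr (s - 1)) / outer_Z h"
    by (simp add: gibbs_def sum_divide_distrib sum_distrib_right inner_Z_def)
  also have "(\<Sum>i\<in>I. inner_Z h i * inner_Z h i powr (s - 1)) = outer_Z h"
    using less_imp_le[OF inner_Z_pos] by (simp add: outer_Z_def powr_mult_base)
  finally show ?thesis by simp
qed

lemma gibbs_le_1:
  assumes "i \<in> I" "j \<in> J"
  shows "gibbs h i j \<le> 1"
proof -
  have "gibbs h i j \<le> (\<Sum>j\<in>J. gibbs h i j)"
    using assms finite_J gibbs_nonneg by (intro member_le_sum) auto
  also have "\<dots> \<le> (\<Sum>i\<in>I. \<Sum>j\<in>J. gibbs h i j)"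
    using assms finite_I gibbs_nonneg by (intro member_le_sum) (auto intro: sum_nonneg)
  finally show ?thesis by (simp add: sum_gibbs)
qed

lemma abs_gibbs_avg_le: "\<bar>gibbs_avg h v\<bar> \<le> (\<Sum>i\<in>I. \<Sum>j\<in>J. \<bar>v i j\<bar>)"
  unfolding gibbs_avg_def
  by (intro order_trans[OF sum_abs] sum_mono)
    (simp add: abs_mult gibbs_nonneg gibbs_le_1 mult_left_le_one_le)

lemma abs_inner_avg_le: "\<bar>inner_avg h v i\<bar> \<le> (\<Sum>j\<in>J. \<bar>v i j\<bar>)"
  unfolding inner_avg_def
proof (intro order_trans[OF sum_abs] sum_mono)
  fix j assume "j \<in> J"
  then have "exp (h i j) \<le> inner_Z h i"
    unfolding inner_Z_def using finite_J by (intro member_le_sum) auto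
  then have le: "exp (h i j) / inner_Z h i \<le> 1"
    by (simp add: divide_le_eq)
  have nonneg: "0 \<le> exp (h i j) / inner_Z h i"
    using less_imp_le[OF inner_Z_pos] by (intro divide_nonneg_nonneg) auto
  show "\<bar>exp (h i j) / inner_Z h i * v i j\<bar> \<le> \<bar>v i j\<bar>"
    unfolding abs_mult abs_of_nonneg[OF nonneg] by (rule mult_left_le_one_le[OF abs_ge_zero nonneg le])
qed

text \<open>The right-hand side is free of \<open>h\<close>, so for fixed \<open>v\<close> it serves
  as the constant \<open>D\<close> in \<open>iid_std_normal_ibp\<close>.\<close>

lemma abs_gibbs_deriv_le:
  assumes "i \<in> I" "j \<in> J"
  shows "\<bar>gibbs_deriv h v i j\<bar>
    \<le> \<bar>v i j\<bar> + \<bar>s - 1\<bar> * (\<Sum>j\<in>J. \<bar>v i j\<bar>) + \<bar>s\<bar> * (\<Sum>i\<in>I. \<Sum>j\<in>J. \<bar>v i j\<bar>)"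
proof -
  let ?e = "v i j + (s - 1) * inner_avg h v i - s * gibbs_avg h v"
  have "\<bar>gibbs_deriv h v i j\<bar> \<le> \<bar>?e\<bar>"
    using assms by (simp add: gibbs_deriv_def abs_mult gibbs_nonneg gibbs_le_1 mult_left_le_one_le)
  also have "\<dots> \<le> \<bar>v i j\<bar> + \<bar>s - 1\<bar> * \<bar>inner_avg h v i\<bar> + \<bar>s\<bar> * \<bar>gibbs_avg h v\<bar>"
    unfolding abs_mult[symmetric] by linarith
  also have "\<dots> \<le> \<bar>v i j\<bar> + \<bar>s - 1\<bar> * (\<Sum>j\<in>J. \<bar>v i j\<bar>) + \<bar>s\<bar> * (\<Sum>i\<in>I. \<Sum>j\<in>J. \<bar>v i j\<bar>)"
    by (intro add_mono mult_left_mono abs_gibbs_avg_le abs_inner_avg_le) auto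
  finally show ?thesis .
qed

section \<open>Measurability for random energies\<close>

lemma measurable_inner_Z [measurable (raw)]:
  assumes "\<And>i j. (\<lambda>\<omega>. h \<omega> i j) \<in> borel_measurable M"
  shows "(\<lambda>\<omega>. inner_Z (h \<omega>) i) \<in> borel_measurable M"
  unfolding inner_Z_def using assms by measurable

lemma measurable_outer_Z [measurable (raw)]:
  assumes "\<And>i j. (\<lambda>\<omega>. h \<omega> i j) \<in> borel_measurable M"
  shows "(\<lambda>\<omega>. outer_Z (h \<omega>)) \<in> borel_measurable M"
  unfolding outer_Z_def using assms by measurable

lemma measurable_gibbs [measurable (raw)]:
  assumes "\<And>i j. (\<lambda>\<omega>. h \<omega> i j) \<in> borel_measurable M"
  shows "(\<lambda>\<omega>. gibbs (h \<omega>) i j) \<in> borel_measurable M"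
  unfolding gibbs_def using assms by measurable

lemma measurable_gibbs_deriv [measurable (raw)]:
  assumes "\<And>i j. (\<lambda>\<omega>. h \<omega> i j) \<in> borel_measurable M"
  shows "(\<lambda>\<omega>. gibbs_deriv (h \<omega>) v i j) \<in> borel_measurable M"
  unfolding gibbs_deriv_def inner_avg_def gibbs_avg_def using assms by measurable

section \<open>Continuity and derivatives along a path of energies\<close>

context
  fixes h :: "real \<Rightarrow> 'i \<Rightarrow> 'j \<Rightarrow> real" and t :: real
begin

lemma isCont_gibbs_deriv:
  assumes [continuous_intros]: "\<And>i j. isCont (\<lambda>t. h t i j) t"
  shows "isCont (\<lambda>t. gibbs_deriv (h t) v i j) t"
proof -
  have [continuous_intros]: "isCont (\<lambda>t. inner_Z (h t) i) t" for i
    unfolding inner_Z_def by (intro continuous_intros)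
  have [continuous_intros]: "isCont (\<lambda>t. outer_Z (h t)) t"
    unfolding outer_Z_def by (intro continuous_intros) auto
  have [continuous_intros]: "isCont (\<lambda>t. gibbs (h t) i j) t" for i j
    unfolding gibbs_def by (intro continuous_intros) auto
  show ?thesis
    unfolding gibbs_deriv_def inner_avg_def gibbs_avg_def by (intro continuous_intros) auto
qed

context
  fixes h' :: "'i \<Rightarrow> 'j \<Rightarrow> real"
  assumes h': "\<And>i j. ((\<lambda>t. h t i j) has_real_derivative h' i j) (at t)"
begin

text \<open>The derivative is kept as the function times its logarithmic derivative, here and for
  \<open>outer_Z\<close>, so that the factors cancel in quotients and logarithms.\<close>

lemma has_derivative_inner_Z:
  "((\<lambda>t. inner_Z (h t) i) has_real_derivative inner_Z (h t) i * inner_avg (h t) h' i) (at t)"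
proof -
  have "((\<lambda>t. inner_Z (h t) i) has_real_derivative (\<Sum>j\<in>J. exp (h t i j) * h' i j)) (at t)"
    unfolding inner_Z_def by (auto intro!: derivative_eq_intros h')
  also have "(\<Sum>j\<in>J. exp (h t i j) * h' i j) = inner_Z (h t) i * inner_avg (h t) h' i"
    by (simp add: inner_avg_def sum_distrib_left)
  finally show ?thesis .
qed

lemma has_derivative_outer_Z:
  "((\<lambda>t. outer_Z (h t)) has_real_derivative outer_Z (h t) * (s * gibbs_avg (h t) h')) (at t)"
proof -
  have "((\<lambda>t. outer_Z (h t)) has_real_derivative
    (\<Sum>i\<in>I. s * inner_Z (h t) i powr (s - 1) * (inner_Z (h t) i * inner_avg (h t) h' i))) (at t)"
    unfolding outer_Z_def
    by (intro DERIV_sum DERIV_cong[OF DERIV_fun_powr[OF has_derivative_inner_Z]]) auto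
  also have "(\<Sum>i\<in>I. s * inner_Z (h t) i powr (s - 1) * (inner_Z (h t) i * inner_avg (h t) h' i))
      = outer_Z (h t) * (s * gibbs_avg (h t) h')"
    unfolding gibbs_avg_def gibbs_def inner_avg_def
    by (simp add: sum_distrib_left field_simps)
  finally show ?thesis .
qed

lemma has_derivative_ln_outer_Z:
  "((\<lambda>t. ln (outer_Z (h t))) has_real_derivative s * gibbs_avg (h t) h') (at t)"
  by (rule DERIV_cong[OF DERIV_chain2[OF DERIV_ln has_derivative_outer_Z]]) auto

text \<open>The three terms of \<open>gibbs_deriv\<close> are the logarithmic derivatives of the
  three factors of \<open>gibbs\<close>: the exponential, the power \<open>s - 1\<close> of
  \<open>inner_Z\<close>, and the reciprocal of \<open>outer_Z\<close>.\<close>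

lemma has_derivative_gibbs:
  "((\<lambda>t. gibbs (h t) i j) has_real_derivative gibbs_deriv (h t) h' i j) (at t)"
proof -
  have p: "((\<lambda>t. inner_Z (h t) i powr (s - 1)) has_real_derivative
      inner_Z (h t) i powr (s - 1) * ((s - 1) * inner_avg (h t) h' i)) (at t)"
    \<comment> \<open>The power rule lowers the exponent to \<open>s - 1 - 1\<close>; the factor
      \<open>inner_Z\<close> in the inner derivative raises it back to \<open>s - 1\<close>.\<close>
    using powr_mult_base[of "inner_Z (h t) i" "s - 1 - 1"] less_imp_le[OF inner_Z_pos]
    by (intro DERIV_cong[OF DERIV_fun_powr[OF has_derivative_inner_Z]]) (auto simp: mult_ac)
  have "((\<lambda>t. gibbs (h t) i j) has_real_derivative
    ((exp (h t i j) * h' i j * inner_Z (h t) i powr (s - 1)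
      + inner_Z (h t) i powr (s - 1) * ((s - 1) * inner_avg (h t) h' i) * exp (h t i j)) * outer_Z (h t)
      - exp (h t i j) * inner_Z (h t) i powr (s - 1) * (outer_Z (h t) * (s * gibbs_avg (h t) h')))
      / (outer_Z (h t) * outer_Z (h t))) (at t)"
    unfolding gibbs_def
    by (intro DERIV_divide DERIV_mult p has_derivative_outer_Z DERIV_chain2[OF DERIV_exp h']) simp
  then show ?thesis
    by (rule DERIV_cong) (simp add: gibbs_deriv_def gibbs_def field_simps)
qed

end
end

text \<open>Mean value inequality on the segment from 0 to \<open>h\<close>, where the derivative is
  \<open>s\<close> times a Gibbs average of \<open>h\<close>. This linear growth makes the logarithm
  integrable for Gaussian energies.\<close>

lemma abs_ln_outer_Z_le:
  "\<bar>ln (outer_Z h)\<bar> \<le> \<bar>ln (outer_Z (\<lambda>_ _. 0))\<bar> + \<bar>s\<bar> * (\<Sum>i\<in>I. \<Sum>j\<in>J. \<bar>h i j\<bar>)"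
proof -
  let ?B = "\<bar>s\<bar> * (\<Sum>i\<in>I. \<Sum>j\<in>J. \<bar>h i j\<bar>)"
  let ?F = "\<lambda>t. ln (outer_Z (\<lambda>i j. t * h i j))"
  have "norm (?F 1 - ?F 0) \<le> ?B * norm (1 - 0 :: real)"
  proof (rule field_differentiable_bound[of UNIV])
    show "(?F has_field_derivative s * gibbs_avg (\<lambda>i j. t * h i j) h) (at t within UNIV)" for t
      by (rule has_derivative_ln_outer_Z[of "\<lambda>t i j. t * h i j" h t])
        (auto intro!: derivative_eq_intros)
    show "norm (s * gibbs_avg (\<lambda>i j. t * h i j) h) \<le> ?B" for t
      by (simp add: abs_mult abs_gibbs_avg_le mult_left_mono)
  qed auto
  then show ?thesis by simp
qed

end

section \<open>Comparison of Gaussian fields\<close>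

text \<open>For i.i.d. standard normal \<open>z\<close>, the covariance of the fields with
  coefficients \<open>c\<close> and \<open>d\<close> is the sum over \<open>k\<close> of the
  products of their coefficients, so covariances can be handled as finite sums.\<close>

definition gaussian_field :: "('k::finite \<Rightarrow> real) \<Rightarrow> ('k \<Rightarrow> 'i \<Rightarrow> 'j \<Rightarrow> real) \<Rightarrow> 'i \<Rightarrow> 'j \<Rightarrow> real" where
  "gaussian_field z c i j = (\<Sum>k\<in>UNIV. z k * c k i j)"

lemma gaussian_field_upd_deriv:
  "((\<lambda>y. gaussian_field (z(k := y)) c i j) has_real_derivative c k i j) (at y)"
proof -
  have "(\<lambda>y. gaussian_field (z(k := y)) c i j) = (\<lambda>y. y * c k i j + (\<Sum>l\<in>UNIV - {k}. z l * c l i j))"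
    unfolding gaussian_field_def by (subst sum.remove[of UNIV k]) auto
  then show ?thesis by (auto intro!: derivative_eq_intros)
qed

context two_level_gibbs
begin

context
  fixes M :: "'w measure" and Z :: "'k::finite \<Rightarrow> 'w \<Rightarrow> real"
  assumes prob: "prob_space M" and iid: "iid_std_normal M Z"
begin

abbreviation field :: "('k \<Rightarrow> 'i \<Rightarrow> 'j \<Rightarrow> real) \<Rightarrow> 'w \<Rightarrow> 'i \<Rightarrow> 'j \<Rightarrow> real" where
  "field c \<omega> \<equiv> gaussian_field (\<lambda>k. Z k \<omega>) c"

lemma measurable_Z [measurable]: "Z k \<in> borel_measurable M"
  using iid by (auto simp: iid_std_normal_def distributed_def)

lemma measurable_field [measurable (raw)]: "(\<lambda>\<omega>. field c \<omega> i j) \<in> borel_measurable M"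
  unfolding gaussian_field_def by measurable

lemma integrable_field: "integrable M (\<lambda>\<omega>. field c \<omega> i j)"
  unfolding gaussian_field_def using iid_std_normal_integrable[OF prob iid] by auto

text \<open>Varying the variable \<open>z k\<close> moves the energies with velocity
  \<open>c k\<close>, so the partial derivative of the weight is \<open>gibbs_deriv\<close> in
  direction \<open>c k\<close>.\<close>

lemma gibbs_ibp:
  assumes "i \<in> I" "j \<in> J"
  shows "(LINT \<omega>|M. Z k \<omega> * gibbs (field c \<omega>) i j) = (LINT \<omega>|M. gibbs_deriv (field c \<omega>) (c k) i j)"
proof (rule iid_std_normal_ibp[OF prob iid,
      where f="\<lambda>z. gibbs (gaussian_field z c) i j" and f'="\<lambda>z. gibbs_deriv (gaussian_field z c) (c k) i j"])
  have [measurable (raw)]: "(\<lambda>z. gaussian_field z c i j) \<in> borel_measurable (Pi\<^sub>M UNIV (\<lambda>_. borel))" for i j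
    unfolding gaussian_field_def by measurable
  show "(\<lambda>z. gibbs (gaussian_field z c) i j) \<in> borel_measurable (Pi\<^sub>M UNIV (\<lambda>_. borel))"
    "(\<lambda>z. gibbs_deriv (gaussian_field z c) (c k) i j) \<in> borel_measurable (Pi\<^sub>M UNIV (\<lambda>_. borel))"
    by measurable
  show "((\<lambda>y. gibbs (gaussian_field (z(k := y)) c) i j) has_real_derivative
    gibbs_deriv (gaussian_field (z(k := y)) c) (c k) i j) (at y)" for z y
    by (rule has_derivative_gibbs[OF gaussian_field_upd_deriv])
  show "isCont (\<lambda>y. gibbs_deriv (gaussian_field (z(k := y)) c) (c k) i j) y" for z y
    by (rule isCont_gibbs_deriv[OF DERIV_isCont[OF gaussian_field_upd_deriv]])
  show "\<bar>gibbs (gaussian_field z c) i j\<bar> \<le> 1" for z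
    by (simp add: abs_of_nonneg gibbs_nonneg gibbs_le_1[OF assms])
qed (rule abs_gibbs_deriv_le[OF assms])

text \<open>Integration by parts turns each \<open>Z k\<close> into a derivative of the weights, and
  the sum over \<open>k\<close> produces the covariances of \<open>d\<close> with \<open>c\<close>.
  The first two terms of \<open>gibbs_deriv\<close> only pair points with the same outer index and
  vanish by \<open>R_zero\<close>. The last one carries \<open>- s\<close>, which with the prefactor
  \<open>s\<close> gives \<open>- (s * s)\<close>, nonpositive for either sign of
  \<open>s\<close>.\<close>

lemma expectation_gibbs_avg_le_0:
  assumes R_nonneg: "\<And>i j i' j'. (\<Sum>k\<in>UNIV. d k i j * c k i' j') \<ge> 0"
    and R_zero: "\<And>i j j'. (\<Sum>k\<in>UNIV. d k i j * c k i j') = 0"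
  shows "(LINT \<omega>|M. s * gibbs_avg (field c \<omega>) (field d \<omega>)) \<le> 0"
proof -
  interpret prob_space M by (rule prob)
  have int1: "integrable M (\<lambda>\<omega>. Z k \<omega> * gibbs (field c \<omega>) i j)" if "i \<in> I" "j \<in> J" for i j k
  proof (rule Bochner_Integration.integrable_bound[OF iid_std_normal_integrable[OF prob iid, of k]])
    show "AE \<omega> in M. norm (Z k \<omega> * gibbs (field c \<omega>) i j) \<le> norm (Z k \<omega>)"
      using gibbs_nonneg gibbs_le_1[OF that] by (auto simp: abs_mult intro!: AE_I2 mult_right_le_one_le)
  qed measurable
  have int2: "integrable M (\<lambda>\<omega>. gibbs_deriv (field c \<omega>) (c k) i j)" if "i \<in> I" "j \<in> J" for i j k
    using abs_gibbs_deriv_le[OF that] by (intro integrable_const_bound AE_I2) auto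
  have point: "(\<Sum>i\<in>I. \<Sum>j\<in>J. \<Sum>k\<in>UNIV. d k i j * gibbs_deriv h (c k) i j)
    = - s * (\<Sum>i\<in>I. \<Sum>j\<in>J. \<Sum>i'\<in>I. \<Sum>j'\<in>J. gibbs h i j * gibbs h i' j' * (\<Sum>k\<in>UNIV. d k i j * c k i' j'))"
    for h
  proof -
    \<comment> \<open>The conditional average stays within the outer index \<open>i\<close>, so
      every covariance occurring in it is zero.\<close>
    have inner: "(\<Sum>k\<in>UNIV. d k i j * inner_avg h (c k) i) = 0" for i j
    proof -
      have "(\<Sum>k\<in>UNIV. d k i j * inner_avg h (c k) i)
        = (\<Sum>j'\<in>J. exp (h i j') / inner_Z h i * (\<Sum>k\<in>UNIV. d k i j * c k i j'))"
        unfolding inner_avg_def sum_distrib_left by (subst sum.swap) (simp add: mult_ac)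
      then show ?thesis by (simp add: R_zero)
    qed
    have outer: "(\<Sum>k\<in>UNIV. d k i j * gibbs_avg h (c k))
      = (\<Sum>i'\<in>I. \<Sum>j'\<in>J. gibbs h i' j' * (\<Sum>k\<in>UNIV. d k i j * c k i' j'))" for i j
    proof -
      have "(\<Sum>k\<in>UNIV. d k i j * gibbs_avg h (c k))
        = (\<Sum>k\<in>UNIV. \<Sum>i'\<in>I. \<Sum>j'\<in>J. gibbs h i' j' * (d k i j * c k i' j'))"
        by (simp add: gibbs_avg_def sum_distrib_left mult_ac)
      also have "\<dots> = (\<Sum>i'\<in>I. \<Sum>k\<in>UNIV. \<Sum>j'\<in>J. gibbs h i' j' * (d k i j * c k i' j'))"
        by (rule sum.swap)
      also have "\<dots> = (\<Sum>i'\<in>I. \<Sum>j'\<in>J. \<Sum>k\<in>UNIV. gibbs h i' j' * (d k i j * c k i' j'))"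
        by (intro sum.cong refl sum.swap)
      finally show ?thesis by (simp add: sum_distrib_left)
    qed
    have "(\<Sum>k\<in>UNIV. d k i j * gibbs_deriv h (c k) i j)
      = gibbs h i j * ((\<Sum>k\<in>UNIV. d k i j * c k i j)
        + (s - 1) * (\<Sum>k\<in>UNIV. d k i j * inner_avg h (c k) i)
        - s * (\<Sum>k\<in>UNIV. d k i j * gibbs_avg h (c k)))" for i j
      unfolding gibbs_deriv_def
      by (simp add: sum_distrib_left sum.distrib sum_subtractf algebra_simps)
    then have "(\<Sum>k\<in>UNIV. d k i j * gibbs_deriv h (c k) i j)
      = - s * (\<Sum>i'\<in>I. \<Sum>j'\<in>J. gibbs h i j * gibbs h i' j' * (\<Sum>k\<in>UNIV. d k i j * c k i' j'))" for i j
      unfolding inner outer R_zero by (simp add: sum_distrib_left sum_negf mult_ac)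
    then show ?thesis by (simp only: sum_distrib_left)
  qed
  \<comment> \<open>Expanding only the averaged field \<open>d\<close> exposes each
    \<open>Z k\<close> as a linear factor; the field \<open>c\<close> inside the weights stays
    intact.\<close>
  have "(LINT \<omega>|M. gibbs_avg (field c \<omega>) (field d \<omega>))
    = (LINT \<omega>|M. (\<Sum>i\<in>I. \<Sum>j\<in>J. \<Sum>k\<in>UNIV. d k i j * (Z k \<omega> * gibbs (field c \<omega>) i j)))"
    unfolding gibbs_avg_def gaussian_field_def[of _ d]
    by (simp add: sum_distrib_left sum_distrib_right mult_ac)
  also have "\<dots> = (\<Sum>i\<in>I. \<Sum>j\<in>J. \<Sum>k\<in>UNIV. d k i j * (LINT \<omega>|M. Z k \<omega> * gibbs (field c \<omega>) i j))"
    by (simp add: int1 cong: sum.cong_simp)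
  also have "\<dots> = (\<Sum>i\<in>I. \<Sum>j\<in>J. \<Sum>k\<in>UNIV. d k i j * (LINT \<omega>|M. gibbs_deriv (field c \<omega>) (c k) i j))"
    by (simp add: gibbs_ibp)
  also have "\<dots> = (LINT \<omega>|M. (\<Sum>i\<in>I. \<Sum>j\<in>J. \<Sum>k\<in>UNIV. d k i j * gibbs_deriv (field c \<omega>) (c k) i j))"
    by (simp add: int2 cong: sum.cong_simp)
  finally have "(LINT \<omega>|M. s * gibbs_avg (field c \<omega>) (field d \<omega>))
    = - (s * s) * (LINT \<omega>|M. (\<Sum>i\<in>I. \<Sum>j\<in>J. \<Sum>i'\<in>I. \<Sum>j'\<in>J. gibbs (field c \<omega>) i j
        * gibbs (field c \<omega>) i' j' * (\<Sum>k\<in>UNIV. d k i j * c k i' j')))"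
    unfolding point by simp
  also have "\<dots> \<le> 0"
    by (intro mult_nonpos_nonneg integral_nonneg_AE AE_I2 sum_nonneg mult_nonneg_nonneg
        gibbs_nonneg R_nonneg) simp
  finally show ?thesis .
qed

text \<open>By \<open>ab\<close> each variable enters at most one of the fields \<open>a\<close> and
  \<open>b\<close>, so they are independent. The velocity of the rotated field \<open>c\<close> is
  \<open>d\<close>, and the mixed terms of their covariance vanish, leaving
  \<open>sin \<theta> * cos \<theta>\<close> times the difference of the covariances of
  \<open>a\<close> and \<open>b\<close>. Both trigonometric factors are nonnegative on the given
  range.\<close>

lemma expectation_ln_outer_Z_antimono:
  fixes a b :: "'k \<Rightarrow> 'i \<Rightarrow> 'j \<Rightarrow> real"
  defines "c \<equiv> \<lambda>\<theta> k i j. sin \<theta> * a k i j + cos \<theta> * b k i j"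
  assumes ab: "\<And>k i j i' j'. a k i j * b k i' j' = 0"
    and cov_le: "\<And>i j i' j'. (\<Sum>k\<in>UNIV. b k i j * b k i' j') \<le> (\<Sum>k\<in>UNIV. a k i j * a k i' j')"
    and cov_eq: "\<And>i j j'. (\<Sum>k\<in>UNIV. b k i j * b k i j') = (\<Sum>k\<in>UNIV. a k i j * a k i j')"
    and \<theta>: "0 \<le> \<theta>\<^sub>1" "\<theta>\<^sub>1 \<le> \<theta>\<^sub>2" "\<theta>\<^sub>2 \<le> pi / 2"
  shows "(LINT \<omega>|M. ln (outer_Z (field (c \<theta>\<^sub>2) \<omega>))) \<le> (LINT \<omega>|M. ln (outer_Z (field (c \<theta>\<^sub>1) \<omega>)))"
proof (rule DERIV_nonpos_imp_nonincreasing[OF \<theta>(2)])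
  interpret prob_space M by (rule prob)
  define d where "d = (\<lambda>\<theta> k i j. cos \<theta> * a k i j - sin \<theta> * b k i j)"
  \<comment> \<open>A dominating function independent of the angle, obtained by bounding sine and
    cosine by 1.\<close>
  define g where "g \<omega> = \<bar>s\<bar> * (\<Sum>i\<in>I. \<Sum>j\<in>J. \<bar>field a \<omega> i j\<bar> + \<bar>field b \<omega> i j\<bar>)" for \<omega>
  have field_c: "field (c \<theta>) \<omega> i j = sin \<theta> * field a \<omega> i j + cos \<theta> * field b \<omega> i j" for \<theta> \<omega> i j
    by (simp add: c_def gaussian_field_def sum_distrib_left sum.distrib algebra_simps)
  have field_d: "field (d \<theta>) \<omega> i j = cos \<theta> * field a \<omega> i j - sin \<theta> * field b \<omega> i j" for \<theta> \<omega> i j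
    by (simp add: d_def gaussian_field_def sum_distrib_left sum_subtractf algebra_simps)
  have deriv: "((\<lambda>\<theta>. LINT \<omega>|M. ln (outer_Z (field (c \<theta>) \<omega>))) has_real_derivative
    (LINT \<omega>|M. s * gibbs_avg (field (c \<theta>) \<omega>) (field (d \<theta>) \<omega>))) (at \<theta>)" for \<theta>
  proof (rule has_real_derivative_integral[where g=g])
    show "((\<lambda>\<theta>. ln (outer_Z (field (c \<theta>) \<omega>))) has_real_derivative
      s * gibbs_avg (field (c \<theta>) \<omega>) (field (d \<theta>) \<omega>)) (at \<theta>)" for \<theta> \<omega>
      by (rule has_derivative_ln_outer_Z) (auto simp: field_c field_d intro!: derivative_eq_intros)
    have d_le: "\<bar>field (d \<theta>) \<omega> i j\<bar> \<le> \<bar>field a \<omega> i j\<bar> + \<bar>field b \<omega> i j\<bar>" for \<theta> \<omega> i j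
    proof -
      have "\<bar>cos \<theta> * field a \<omega> i j\<bar> \<le> \<bar>field a \<omega> i j\<bar>" "\<bar>sin \<theta> * field b \<omega> i j\<bar> \<le> \<bar>field b \<omega> i j\<bar>"
        by (simp_all add: abs_mult mult_left_le_one_le)
      then show ?thesis unfolding field_d by linarith
    qed
    show "\<bar>s * gibbs_avg (field (c \<theta>) \<omega>) (field (d \<theta>) \<omega>)\<bar> \<le> g \<omega>" for \<theta> \<omega>
      unfolding g_def abs_mult
      by (intro mult_left_mono order_trans[OF abs_gibbs_avg_le] sum_mono d_le) simp
    show "integrable M (\<lambda>\<omega>. ln (outer_Z (field (c \<theta>) \<omega>)))" for \<theta>
    proof (rule Bochner_Integration.integrable_bound)
      show "integrable M (\<lambda>\<omega>. \<bar>ln (outer_Z (\<lambda>_ _. 0))\<bar> + \<bar>s\<bar> * (\<Sum>i\<in>I. \<Sum>j\<in>J. \<bar>field (c \<theta>) \<omega> i j\<bar>))"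
        using integrable_field by auto
      show "AE \<omega> in M. norm (ln (outer_Z (field (c \<theta>) \<omega>)))
        \<le> norm (\<bar>ln (outer_Z (\<lambda>_ _. 0))\<bar> + \<bar>s\<bar> * (\<Sum>i\<in>I. \<Sum>j\<in>J. \<bar>field (c \<theta>) \<omega> i j\<bar>))"
        unfolding real_norm_def by (intro AE_I2 order_trans[OF abs_ln_outer_Z_le abs_ge_self])
    qed measurable
    show "integrable M g"
      unfolding g_def using integrable_field by auto
    show "(\<lambda>\<omega>. s * gibbs_avg (field (c \<theta>) \<omega>) (field (d \<theta>) \<omega>)) \<in> borel_measurable M" for \<theta>
      unfolding gibbs_avg_def by measurable
  qed
  have cov: "(\<Sum>k\<in>UNIV. d \<theta> k i j * c \<theta> k i' j')
    = sin \<theta> * cos \<theta> * ((\<Sum>k\<in>UNIV. a k i j * a k i' j') - (\<Sum>k\<in>UNIV. b k i j * b k i' j'))" for \<theta> i j i' j'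
  proof -
    have "d \<theta> k i j * c \<theta> k i' j' = sin \<theta> * cos \<theta> * (a k i j * a k i' j' - b k i j * b k i' j')" for k
    proof -
      have "d \<theta> k i j * c \<theta> k i' j' = sin \<theta> * cos \<theta> * (a k i j * a k i' j' - b k i j * b k i' j')
        + cos \<theta> * cos \<theta> * (a k i j * b k i' j') - sin \<theta> * sin \<theta> * (a k i' j' * b k i j)"
        by (simp add: c_def d_def algebra_simps)
      then show ?thesis by (simp only: ab)
    qed
    then show ?thesis by (simp only: sum_distrib_left[symmetric] sum_subtractf)
  qed
  show "\<exists>y. ((\<lambda>\<theta>. LINT \<omega>|M. ln (outer_Z (field (c \<theta>) \<omega>))) has_real_derivative y) (at \<theta>) \<and> y \<le> 0"
    if "\<theta>\<^sub>1 \<le> \<theta>" "\<theta> \<le> \<theta>\<^sub>2" for \<theta>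
  proof (intro exI conjI)
    have "0 \<le> sin \<theta>" "0 \<le> cos \<theta>"
      using that \<theta> by (auto intro!: sin_ge_zero cos_ge_zero)
    then show "(LINT \<omega>|M. s * gibbs_avg (field (c \<theta>) \<omega>) (field (d \<theta>) \<omega>)) \<le> 0"
      by (intro expectation_gibbs_avg_le_0) (simp_all add: cov cov_le cov_eq)
  qed (rule deriv)
qed

end

end

section \<open>The bilinear process\<close>

lemma sum_UNIV_Plus:
  fixes f :: "'a::finite + 'b::finite \<Rightarrow> 'c::comm_monoid_add"
  shows "(\<Sum>k\<in>UNIV. f k) = (\<Sum>k\<in>UNIV. f (Inl k)) + (\<Sum>k\<in>UNIV. f (Inr k))"
  unfolding UNIV_Plus_UNIV[symmetric] by (subst sum.Plus) auto

lemma sum_UNIV_prod: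
  fixes f :: "'a::finite \<times> 'b::finite \<Rightarrow> 'c::comm_monoid_add"
  shows "(\<Sum>k\<in>UNIV. f k) = (\<Sum>p\<in>UNIV. \<Sum>q\<in>UNIV. f (p, q))"
  unfolding UNIV_Times_UNIV[symmetric] by (simp only: sum.cartesian_product split_def prod.collapse)

text \<open>The left side is the covariance of the bilinear forms of a standard Gaussian matrix at
  two pairs of vectors.\<close>

lemma inner_mult_inner_eq_sum:
  fixes x x' :: "real ^ 'n" and y y' :: "real ^ 'm"
  shows "(\<Sum>p\<in>UNIV. \<Sum>q\<in>UNIV. (y $ p * x $ q) * (y' $ p * x' $ q)) = (y \<bullet> y') * (x \<bullet> x')"
  by (simp add: inner_vec_def sum_product mult_ac)

theorem theorem1:
  fixes M :: "'w measure"
    and G :: "'w \<Rightarrow> real ^ 'n ^ 'm"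
    and u4 :: "'w \<Rightarrow> real"
    and u2 :: "'w \<Rightarrow> real ^ 'm"
    and h :: "'w \<Rightarrow> real ^ 'n"
    and l :: nat
    and x :: "nat \<Rightarrow> real ^ 'n"
    and y :: "nat \<Rightarrow> real ^ 'm"
    and \<beta> s :: real
  assumes "prob_space M"
    and "iid_std_normal M (scalar_components G u4 u2 h)"
    and "l \<ge> 1"
    and "\<beta> > 0"
    and "s \<noteq> 0"
  shows "antimono_on {0..1} (\<lambda>t. psi M G u4 u2 h l x y \<beta> s t)"
proof -
  let ?Z = "scalar_components G u4 u2 h"
  interpret two_level_gibbs "{1..l}" "{1..l}" s
    using assms(3) by unfold_locales auto
  \<comment> \<open>\<open>a\<close> collects the coefficients of the matrix entries and the scalar
    (the terms with \<open>sqrt t\<close>), \<open>b\<close> those of the two vectors (the terms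
    with \<open>sqrt (1 - t)\<close>). Both absorb \<beta>.\<close>
  define a :: "('m \<times> 'n) + unit + 'm + 'n \<Rightarrow> nat \<Rightarrow> nat \<Rightarrow> real" where
    "a k i j = \<beta> * case_sum (\<lambda>(p, q). y j $ p * x i $ q)
       (case_sum (\<lambda>_. norm (x i) * norm (y j)) (\<lambda>_. 0)) k" for k i j
  define b :: "('m \<times> 'n) + unit + 'm + 'n \<Rightarrow> nat \<Rightarrow> nat \<Rightarrow> real" where
    "b k i j = \<beta> * case_sum (\<lambda>_. 0) (case_sum (\<lambda>_. 0)
       (case_sum (\<lambda>p. norm (x i) * y j $ p) (\<lambda>q. norm (y j) * x i $ q))) k" for k i j
  define c where "c \<theta> k i j = sin \<theta> * a k i j + cos \<theta> * b k i j" for \<theta> k i j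
  \<comment> \<open>The angle \<open>arcsin (sqrt t)\<close> has sine \<open>sqrt t\<close> and
    cosine \<open>sqrt (1 - t)\<close>.\<close>
  have H_eq: "\<beta> * H (G \<omega>) (u4 \<omega>) (u2 \<omega>) (h \<omega>) t (x i) (y j)
    = gaussian_field (\<lambda>k. ?Z k \<omega>) (c (arcsin (sqrt t))) i j" if "t \<in> {0..1}" for t \<omega> i j
  proof -
    let ?\<theta> = "arcsin (sqrt t)"
    have "- 1 \<le> sqrt t" "sqrt t \<le> 1"
      using that order_trans[of "- 1" 0 "sqrt t"] by simp_all
    then have trig: "sin ?\<theta> = sqrt t" "cos ?\<theta> = sqrt (1 - t)"
      using that by (simp_all add: cos_arcsin)
    have "y j \<bullet> (G \<omega> *v x i) = (\<Sum>p\<in>UNIV. \<Sum>q\<in>UNIV. G \<omega> $ p $ q * (y j $ p * x i $ q))"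
      by (simp add: inner_vec_def matrix_vector_mult_def sum_distrib_left mult_ac)
    moreover have "y j \<bullet> u2 \<omega> = (\<Sum>p\<in>UNIV. u2 \<omega> $ p * y j $ p)" "h \<omega> \<bullet> x i = (\<Sum>q\<in>UNIV. h \<omega> $ q * x i $ q)"
      by (simp_all add: inner_vec_def mult_ac)
    ultimately show ?thesis
      unfolding H_def gaussian_field_def sum_UNIV_Plus sum_UNIV_prod c_def trig
      by (simp add: a_def b_def scalar_components_def UNIV_unit distrib_left sum_distrib_left mult_ac)
  qed
  have cov_a: "(\<Sum>k\<in>UNIV. a k i j * a k i' j')
    = \<beta> * \<beta> * ((y j \<bullet> y j') * (x i \<bullet> x i') + norm (x i) * norm (y j) * (norm (x i') * norm (y j')))"
    for i j i' j'
    unfolding inner_mult_inner_eq_sum[symmetric] sum_UNIV_Plus sum_UNIV_prod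
    by (simp add: a_def UNIV_unit distrib_left sum_distrib_left mult_ac)
  have cov_b: "(\<Sum>k\<in>UNIV. b k i j * b k i' j')
    = \<beta> * \<beta> * (norm (x i) * norm (x i') * (y j \<bullet> y j') + norm (y j) * norm (y j') * (x i \<bullet> x i'))"
    for i j i' j'
    unfolding sum_UNIV_Plus by (simp add: b_def inner_vec_def distrib_left sum_distrib_left mult_ac)
  \<comment> \<open>The scalar variable supplies the product of all four norms that completes this
    factorization; by Cauchy-Schwarz both factors are nonnegative.\<close>
  have cov_diff: "(\<Sum>k\<in>UNIV. a k i j * a k i' j') - (\<Sum>k\<in>UNIV. b k i j * b k i' j')
    = \<beta> * \<beta> * ((norm (x i) * norm (x i') - x i \<bullet> x i') * (norm (y j) * norm (y j') - y j \<bullet> y j'))"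
    for i j i' j'
    unfolding cov_a cov_b by (simp add: algebra_simps)
  have psi_eq: "psi M G u4 u2 h l x y \<beta> s t = 1 / (\<beta> * \<bar>s\<bar> * sqrt (real CARD('n)))
    * (LINT \<omega>|M. ln (outer_Z (gaussian_field (\<lambda>k. ?Z k \<omega>) (c (arcsin (sqrt t))))))"
    if "t \<in> {0..1}" for t
    unfolding psi_def outer_Z_def inner_Z_def H_eq[OF that] by simp
  show ?thesis
  proof (rule monotone_onI)
    fix t\<^sub>1 t\<^sub>2 :: real assume t: "t\<^sub>1 \<in> {0..1}" "t\<^sub>2 \<in> {0..1}" "t\<^sub>1 \<le> t\<^sub>2"
    have "(LINT \<omega>|M. ln (outer_Z (gaussian_field (\<lambda>k. ?Z k \<omega>) (c (arcsin (sqrt t\<^sub>2))))))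
      \<le> (LINT \<omega>|M. ln (outer_Z (gaussian_field (\<lambda>k. ?Z k \<omega>) (c (arcsin (sqrt t\<^sub>1))))))"
      unfolding c_def
    proof (rule expectation_ln_outer_Z_antimono[OF assms(1,2)])
      show "a k i j * b k i' j' = 0" for k i j i' j'
        by (simp add: a_def b_def split: sum.split)
      show "(\<Sum>k\<in>UNIV. b k i j * b k i' j') \<le> (\<Sum>k\<in>UNIV. a k i j * a k i' j')" for i j i' j'
      proof -
        have "0 \<le> \<beta> * \<beta> * ((norm (x i) * norm (x i') - x i \<bullet> x i') * (norm (y j) * norm (y j') - y j \<bullet> y j'))"
          using assms(4) by (intro mult_nonneg_nonneg) (simp_all add: norm_cauchy_schwarz)
        then show ?thesis unfolding cov_diff[symmetric] by simp
      qed
      show "(\<Sum>k\<in>UNIV. b k i j * b k i j') = (\<Sum>k\<in>UNIV. a k i j * a k i j')" for i j j'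
        \<comment> \<open>For equal outer indices the factor from the \<open>x\<close> vectors is
          the squared norm minus itself.\<close>
        using cov_diff[of i j i j'] unfolding dot_square_norm[of "x i", unfolded power2_eq_square]
        by simp
      \<comment> \<open>The angle is nondecreasing in \<open>t\<close>, so monotonicity in the angle
        carries over to \<open>t\<close>.\<close>
      have "0 \<le> sqrt t\<^sub>1" "sqrt t\<^sub>1 \<le> sqrt t\<^sub>2" "sqrt t\<^sub>2 \<le> 1"
        using t by simp_all
      moreover from this have "- 1 \<le> sqrt t\<^sub>1" "- 1 \<le> sqrt t\<^sub>2"
        by linarith+
      ultimately show "0 \<le> arcsin (sqrt t\<^sub>1)" "arcsin (sqrt t\<^sub>1) \<le> arcsin (sqrt t\<^sub>2)"
        "arcsin (sqrt t\<^sub>2) \<le> pi / 2"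
        using arcsin_le_arcsin[of 0 "sqrt t\<^sub>1"] arcsin_le_arcsin[of "sqrt t\<^sub>1" "sqrt t\<^sub>2"]
          arcsin_ubound[of "sqrt t\<^sub>2"] by auto
    qed
    then show "psi M G u4 u2 h l x y \<beta> s t\<^sub>2 \<le> psi M G u4 u2 h l x y \<beta> s t\<^sub>1"
      unfolding psi_eq[OF t(1)] psi_eq[OF t(2)] using assms(4)
      by (intro mult_left_mono) auto
  qed
qed

end
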